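(* Let $G=A\rtimes \langle t\rangle$ with $A$ finite abelian and $|t|=\omega$. For each divisor $n\mid \omega$ let \[ B_n:=\langle t^{\omega/n}\rangle\le \langle t\rangle, \qquad C_n:=\mathrm{C}_A(B_n). \] Then for every $r\ge 1$, \[ |\mathrm{Hom}(\mathbb Z^r,G)|=\sum_{n\mid \omega}|A:C_n|\,|C_n|^r\,J_r(n), \] where $J_r(n)$ is the $r$th Jordan totient, equivalently \[ J_r(n)=\#\{(b_1,\dots,b_r)\in B_n^r:\ \langle b_1,\dots,b_r\rangle=B_n\} =\sum_{d\mid n}\mu(d)\Bigl(\frac{n}{d}\Bigr)^r. \] Equivalently, \[ |\mathrm{Hom}(\mathbb Z^r,G)|= \sum_{n\mid \omega}\sum_{d\mid n}\mu(d)\,|A:C_n|\Bigl(\frac{|C_n|\,n}{d}\Bigr)^r. \]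
   Context: $A$ is the normal factor of the semidirect product, $\langle t\rangle$ is a cyclic group of order $\omega$ acting on $A$ by automorphisms (not necessarily faithfully), and $\mathrm{C}_A(B)$ is the subgroup of elements of $A$ fixed by every element of $B\le\langle t\rangle$. $\mathrm{Hom}(\mathbb Z^r,G)$ is the set of pairwise commuting $r$-tuples in $G^r$. $\mu(d)$ is the number-theoretic Möbius function. *)

theory Defs
  imports "HOL-Algebra.Generated_Groups" "HOL-Algebra.Multiplicative_Group" "HOL-Algebra.Bij"
    "HOL-Computational_Algebra.Squarefree"
begin

text \<open>The external semidirect product for a left action
  \<open>act \<in> hom T (AutoGroup A)\<close> (no faithfulness is required).\<close>

definition semidirect ::
  "('a, 'm) monoid_scheme \<Rightarrow> ('b, 'n) monoid_scheme \<Rightarrow> ('b \<Rightarrow> 'a \<Rightarrow> 'a) \<Rightarrow> ('a \<times> 'b) monoid"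
  where "semidirect A T act =
    \<lparr>carrier = carrier A \<times> carrier T,
     monoid.mult = (\<lambda>(a, x) (b, y). (a \<otimes>\<^bsub>A\<^esub> act x b, x \<otimes>\<^bsub>T\<^esub> y)),
     one = (\<one>\<^bsub>A\<^esub>, \<one>\<^bsub>T\<^esub>)\<rparr>"

lemma group_semidirect:
  assumes A: "group A" and T: "group T" and act: "act \<in> hom T (AutoGroup A)"
  shows "group (semidirect A T act)"
proof -
  interpret A: group A by (rule A)
  interpret T: group T by (rule T)
  have autom: "act x \<in> auto A" if "x \<in> carrier T" for x
    using act that by (auto simp: hom_def AutoGroup_def)
  have closed: "act x a \<in> carrier A" if "x \<in> carrier T" "a \<in> carrier A" for x a
    using autom[OF that(1)] that(2) by (auto simp: auto_def hom_def)
  have mult: "act x (a \<otimes>\<^bsub>A\<^esub> b) = act x a \<otimes>\<^bsub>A\<^esub> act x b"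
    if "x \<in> carrier T" "a \<in> carrier A" "b \<in> carrier A" for x a b
    using autom[OF that(1)] that(2,3) by (auto simp: auto_def hom_def)
  have act_mult: "act (x \<otimes>\<^bsub>T\<^esub> y) a = act x (act y a)"
    if "x \<in> carrier T" "y \<in> carrier T" "a \<in> carrier A" for x y a
    using act that autom[OF that(1)] autom[OF that(2)]
    by (simp add: hom_def AutoGroup_def BijGroup_def auto_def compose_def)
  have "act \<one>\<^bsub>T\<^esub> = \<one>\<^bsub>AutoGroup A\<^esub>"
    using act T A.AutoGroup by (rule hom_one)
  then have act_one: "act \<one>\<^bsub>T\<^esub> a = a" if "a \<in> carrier A" for a
    using that by (simp add: AutoGroup_def BijGroup_def)
  have linv: "act (inv\<^bsub>T\<^esub> x) (inv\<^bsub>A\<^esub> a) \<otimes>\<^bsub>A\<^esub> act (inv\<^bsub>T\<^esub> x) a = \<one>\<^bsub>A\<^esub>"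
    if "x \<in> carrier T" "a \<in> carrier A" for x a
  proof -
    have "act (inv\<^bsub>T\<^esub> x) \<in> hom A A"
      using autom[of "inv\<^bsub>T\<^esub> x"] that by (simp add: auto_def)
    then have "act (inv\<^bsub>T\<^esub> x) \<one>\<^bsub>A\<^esub> = \<one>\<^bsub>A\<^esub>"
      using A A by (rule hom_one)
    then show ?thesis
      using that by (simp flip: mult)
  qed
  show ?thesis
  proof (rule groupI)
    fix p assume "p \<in> carrier (semidirect A T act)"
    then obtain a x where p: "p = (a, x)" "a \<in> carrier A" "x \<in> carrier T"
      by (auto simp: semidirect_def)
    show "\<exists>q\<in>carrier (semidirect A T act).
      q \<otimes>\<^bsub>semidirect A T act\<^esub> p = \<one>\<^bsub>semidirect A T act\<^esub>"
      by (rule bexI[of _ "(act (inv\<^bsub>T\<^esub> x) (inv\<^bsub>A\<^esub> a), inv\<^bsub>T\<^esub> x)"])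
        (use p in \<open>auto simp: semidirect_def linv closed\<close>)
  qed (auto simp: semidirect_def closed mult act_mult act_one A.m_assoc T.m_assoc)
qed

definition fixed_points :: "('a, 'm) monoid_scheme \<Rightarrow> ('b \<Rightarrow> 'a \<Rightarrow> 'a) \<Rightarrow> 'b set \<Rightarrow> 'a set"
  where "fixed_points A act B = {a \<in> carrier A. \<forall>b\<in>B. act b a = a}"

definition B_sub :: "('b, 'n) monoid_scheme \<Rightarrow> 'b \<Rightarrow> nat \<Rightarrow> nat \<Rightarrow> 'b set"
  where "B_sub T t \<omega> n = generate T {t [^]\<^bsub>T\<^esub> (\<omega> div n)}"

definition C_sub ::
  "('a, 'm) monoid_scheme \<Rightarrow> ('b, 'n) monoid_scheme \<Rightarrow> ('b \<Rightarrow> 'a \<Rightarrow> 'a) \<Rightarrow> 'b \<Rightarrow> nat \<Rightarrow> nat \<Rightarrow> 'a set"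
  where "C_sub A T act t \<omega> n = fixed_points A act (B_sub T t \<omega> n)"

definition grp_index :: "('a, 'm) monoid_scheme \<Rightarrow> 'a set \<Rightarrow> nat"
  where "grp_index G H = card (rcosets\<^bsub>G\<^esub> H)"

text \<open>\<open>Hom(\<int>\<^sup>r, G)\<close>, identified with the pairwise commuting \<open>r\<close>-tuples in \<open>G\<^sup>r\<close>;
  tuples are extensional functions on \<open>{..<r}\<close>.\<close>

definition Hom_Zr :: "nat \<Rightarrow> ('a, 'm) monoid_scheme \<Rightarrow> (nat \<Rightarrow> 'a) set"
  where "Hom_Zr r G = {g \<in> {..<r} \<rightarrow>\<^sub>E carrier G.
    \<forall>i<r. \<forall>j<r. g i \<otimes>\<^bsub>G\<^esub> g j = g j \<otimes>\<^bsub>G\<^esub> g i}"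

definition moebius :: "nat \<Rightarrow> int"
  where "moebius d = (if squarefree d then (- 1) ^ card (prime_factors d) else 0)"

text \<open>The classical Jordan totient: the number of \<open>r\<close>-tuples from \<open>{1..n}\<close> that together
  with \<open>n\<close> have greatest common divisor 1.\<close>

definition jordan_totient :: "nat \<Rightarrow> nat \<Rightarrow> nat"
  where "jordan_totient r n =
    card {k \<in> {..<r} \<rightarrow>\<^sub>E {1..n}. Gcd (insert n (k ` {..<r})) = 1}"

end

theory Submission
  imports Defs
begin

text \<open>Sort the commuting tuples by their image \<open>x\<close> in \<open>\<langle>t\<rangle>\<^sup>r\<close>. Replacing \<open>g\<^sub>i\<close> by
  \<open>g\<^sub>i g\<^sub>j\<^sup>-\<^sup>1\<close> is a bijection between the commuting lifts of \<open>x\<close> and those of the tuple in which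
  \<open>x\<^sub>i\<close> is replaced by \<open>x\<^sub>i x\<^sub>j\<^sup>-\<^sup>1\<close>, and it preserves the subgroup \<open>B\<close> generated by \<open>x\<close>. Running
  Euclid's algorithm on the exponents of \<open>t\<close> therefore reduces to \<open>x = (s, 1, \<dots>, 1)\<close>. There a lift
  commutes iff all its entries but the first lie in \<open>C = C\<^sub>A(B)\<close>, so there are
  \<open>|A| |C|\<^sup>r\<^sup>-\<^sup>1 = |A:C| |C|\<^sup>r\<close> lifts, depending only on \<open>B\<close>.\<close>

section \<open>The Moebius function and the Jordan totient\<close>

lemma moebius_prime_mult:
  assumes "prime p" "\<not> p dvd d" "d > 0"
  shows "moebius (p * d) = - moebius d"
proof -
  have cop: "coprime p d"
    using assms by (simp add: prime_imp_coprime)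
  have sq: "squarefree (p * d) \<longleftrightarrow> squarefree d"
    using cop assms(1) by (auto intro: squarefree_mult_coprime squarefree_prime dest: squarefree_multD)
  have "prime_factors (p * d) = insert p (prime_factors d)"
    using assms by (subst prime_factors_product) (auto simp: prime_prime_factors)
  moreover have "p \<notin> prime_factors d"
    using assms(2) by auto
  ultimately have "card (prime_factors (p * d)) = Suc (card (prime_factors d))"
    by simp
  then show ?thesis
    by (simp add: moebius_def sq)
qed

text \<open>For a fixed prime \<open>p\<close> dividing \<open>g\<close>, the squarefree divisors of
  \<open>g\<close> fall into pairs \<open>d\<close>, \<open>p * d\<close> with \<open>d\<close>
  prime to \<open>p\<close>. The two values in a pair cancel, and the remaining divisors contribute
  zero.\<close>

lemma sum_moebius_divisors:
  assumes "g > 0"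
  shows "(\<Sum>d | d dvd g. moebius d) = (if g = 1 then 1 else 0)"
proof (cases "g = 1")
  case True
  then show ?thesis by (simp add: moebius_def)
next
  case False
  then obtain p where p: "prime p" "p dvd g"
    using prime_factor_nat by blast
  have fin: "finite {d. d dvd g}"
    using assms by simp
  let ?S = "{d. d dvd g \<and> squarefree d}"
  let ?U = "{d \<in> ?S. \<not> p dvd d}" and ?V = "{d \<in> ?S. p dvd d}"
  have "bij_betw ((*) p) ?U ?V"
  proof (rule bij_betwI')
    fix x y assume "x \<in> ?U" "y \<in> ?U"
    then show "(p * x = p * y) = (x = y)"
      using p(1) by (simp add: prime_gt_0_nat)
  next
    fix x assume x: "x \<in> ?U"
    then have "coprime p x"
      using p(1) by (simp add: prime_imp_coprime)
    then show "p * x \<in> ?V"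
      using x p by (auto intro: divides_mult squarefree_mult_coprime squarefree_prime)
  next
    fix y assume y: "y \<in> ?V"
    then obtain x where x: "y = p * x" by (auto elim: dvdE)
    have "\<not> p dvd x"
    proof
      assume "p dvd x"
      then have "p ^ 2 dvd y"
        by (simp add: x power2_eq_square)
      then have "p dvd 1"
        using y unfolding squarefree_def by blast
      with p(1) show False
        by (simp add: prime_nat_iff)
    qed
    then have "x \<in> ?U"
      using y x by (auto dest: squarefree_multD dvd_mult_right)
    with x show "\<exists>x\<in>?U. y = p * x" by blast
  qed
  then have "(\<Sum>d\<in>?V. moebius d) = (\<Sum>d\<in>?U. moebius (p * d))"
    by (rule sum.reindex_bij_betw[symmetric])
  also have "\<dots> = (\<Sum>d\<in>?U. - moebius d)"
  proof (rule sum.cong)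
    fix d assume "d \<in> ?U"
    then show "moebius (p * d) = - moebius d"
      using p(1) assms by (intro moebius_prime_mult) (auto intro: dvd_pos_nat)
  qed simp
  finally have "(\<Sum>d\<in>?V. moebius d) + (\<Sum>d\<in>?U. moebius d) = 0"
    by (simp add: sum_negf)
  moreover have "(\<Sum>d\<in>?V. moebius d) + (\<Sum>d\<in>?U. moebius d) = (\<Sum>d\<in>?V \<union> ?U. moebius d)"
    using fin by (intro sum.union_disjoint[symmetric]) auto
  moreover have "(\<Sum>d\<in>?V \<union> ?U. moebius d) = (\<Sum>d | d dvd g. moebius d)"
    using fin by (intro sum.mono_neutral_left) (auto simp: moebius_def)
  ultimately show ?thesis
    using False by simp
qed

lemma card_multiples_atMost:
  fixes d n :: nat
  assumes "d dvd n" "n > 0"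
  shows "card {k \<in> {1..n}. d dvd k} = n div d"
proof -
  have d: "d > 0"
    using assms by (auto intro: dvd_pos_nat)
  have "{k \<in> {1..n}. d dvd k} = (*) d ` {1..n div d}"
  proof (intro equalityI subsetI)
    fix k assume "k \<in> {k \<in> {1..n}. d dvd k}"
    then show "k \<in> (*) d ` {1..n div d}"
      using d by (auto elim!: dvdE simp: less_eq_div_iff_mult_less_eq mult.commute)
  next
    fix k assume "k \<in> (*) d ` {1..n div d}"
    then show "k \<in> {k \<in> {1..n}. d dvd k}"
      using d by (auto simp: less_eq_div_iff_mult_less_eq mult.commute)
  qed
  then show ?thesis
    using d by (simp add: card_image inj_on_def)
qed

text \<open>Moebius inversion: the indicator of gcd 1 is written as the sum of
  \<open>moebius d\<close> over the divisors of the gcd, and the two sums are exchanged. For each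
  \<open>d\<close> this leaves the tuples whose entries are all multiples of \<open>d\<close>, of
  which there are \<open>(n div d) ^ r\<close>.\<close>

lemma jordan_totient_moebius:
  assumes n: "n > 0"
  shows "int (jordan_totient r n) = (\<Sum>d | d dvd n. moebius d * int (n div d) ^ r)"
proof -
  let ?P = "{..<r} \<rightarrow>\<^sub>E {1..n}"
  let ?g = "\<lambda>k. Gcd (insert n (k ` {..<r}))"
  have finP: "finite ?P"
    by (simp add: finite_PiE)
  have finD: "finite {d. d dvd n}"
    using n by simp
  \<comment> \<open>The modulus \<open>n\<close> belongs to the set, so its gcd cannot vanish,
    whatever \<open>k\<close> is, and it has finitely many divisors.\<close>
  have g: "?g k > 0" for k
    using n by (simp add: Gcd_insert)
  have dvd_g: "d dvd ?g k \<longleftrightarrow> d dvd n \<and> (\<forall>i<r. d dvd k i)" for d k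
    by (auto simp: dvd_Gcd_iff)
  have count: "card {k \<in> ?P. \<forall>i<r. d dvd k i} = (n div d) ^ r" if "d dvd n" for d
  proof -
    have "{k \<in> ?P. \<forall>i<r. d dvd k i} = {..<r} \<rightarrow>\<^sub>E {k \<in> {1..n}. d dvd k}"
      unfolding set_eq_iff PiE_iff mem_Collect_eq by blast
    then show ?thesis
      using card_multiples_atMost[OF that n] by (simp add: card_PiE)
  qed
  have "int (jordan_totient r n) = (\<Sum>k\<in>?P. if ?g k = 1 then 1 else 0)"
    using finP by (simp add: jordan_totient_def sum.If_cases Int_def)
  also have "\<dots> = (\<Sum>k\<in>?P. \<Sum>d | d dvd ?g k. moebius d)"
    by (intro sum.cong refl sum_moebius_divisors[OF g, symmetric])
  also have "\<dots> = (\<Sum>k\<in>?P. \<Sum>d | d dvd n \<and> (\<forall>i<r. d dvd k i). moebius d)"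
    by (simp only: dvd_g)
  also have "\<dots> = (\<Sum>d | d dvd n. \<Sum>k | k \<in> ?P \<and> (\<forall>i<r. d dvd k i). moebius d)"
    using sum.swap_restrict[OF finP finD, of "\<lambda>k d. moebius d" "\<lambda>k d. \<forall>i<r. d dvd k i"]
    by simp
  also have "\<dots> = (\<Sum>d | d dvd n. moebius d * int (n div d) ^ r)"
    by (intro sum.cong refl) (simp add: count mult.commute del: One_nat_def)
  finally show ?thesis .
qed

section \<open>Generating tuples of cyclic groups\<close>

lemma div_div_divisor_nat:
  fixes a b :: nat
  assumes "a dvd b" "b > 0"
  shows "b div (b div a) = a"
  using assms by (auto elim!: dvdE)

context group
begin

text \<open>Bezout's identity, applied one exponent at a time, writes the gcd as an integer
  combination of the exponents, so the power in question is a product of integer powers of elements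
  of \<open>H\<close>.\<close>

lemma pow_Gcd_in_subgroup:
  fixes S :: "nat set"
  assumes a: "a \<in> carrier G" and H: "subgroup H G" and "finite S" "\<And>m. m \<in> S \<Longrightarrow> a [^] m \<in> H"
  shows "a [^] Gcd S \<in> H"
  using assms(3,4)
proof (induction S rule: finite_induct)
  \<comment> \<open>The gcd of the empty set is 0, so the power is the identity.\<close>
  case empty
  then show ?case
    using H by (simp add: subgroup.one_closed)
next
  case (insert m S)
  then have m: "a [^] int m \<in> H" and s: "a [^] int (Gcd S) \<in> H"
    by (auto simp: int_pow_int)
  obtain u v where uv: "u * int m + v * int (Gcd S) = gcd (int m) (int (Gcd S))"
    using bezout_int by blast
  have "a [^] gcd m (Gcd S) = a [^] int (gcd m (Gcd S))"
    by (simp add: int_pow_int)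
  also have "\<dots> = a [^] (int m * u + int (Gcd S) * v)"
    using uv by (simp add: mult.commute)
  also have "\<dots> = (a [^] int m) [^] u \<otimes> (a [^] int (Gcd S)) [^] v"
    using a by (simp add: int_pow_mult int_pow_pow)
  also have "\<dots> \<in> H"
    using subgroup_int_pow_closed[OF H m] subgroup_int_pow_closed[OF H s]
    by (rule subgroup.m_closed[OF H])
  finally show ?case
    by simp
qed

text \<open>Inserting \<open>ord a\<close> among the exponents only adds the identity as a
  generator, but it makes the gcd a divisor of \<open>ord a\<close>, so that the order of the
  subgroup can be read off.\<close>

lemma generate_powers_eq_Gcd:
  assumes a: "a \<in> carrier G" and I: "finite I"
  shows "generate G ((\<lambda>i. a [^] (k i :: nat)) ` I) = generate G {a [^] Gcd (insert (ord a) (k ` I))}"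
    (is "generate G ?X = generate G {a [^] ?g}")
proof (rule equalityI; rule generate_subgroup_incl)
  have "a [^] k i \<in> generate G {a [^] ?g}" if "i \<in> I" for i
  proof -
    have "?g dvd k i"
      using that by (intro Gcd_dvd) auto
    then obtain q where "k i = ?g * q" by (elim dvdE)
    then have "a [^] k i = (a [^] ?g) [^] int q"
      using a by (simp add: nat_pow_pow int_pow_int)
    then show ?thesis
      using a by (simp add: generate_is_subgroup subgroup_int_pow_closed generate.incl)
  qed
  then show "?X \<subseteq> generate G {a [^] ?g}"
    by blast
  have "a [^] ?g \<in> generate G ?X"
  proof (rule pow_Gcd_in_subgroup[OF a])
    show "subgroup (generate G ?X) G"
      using a by (intro generate_is_subgroup) auto
    show "finite (insert (ord a) (k ` I))"
      using I by simp
    show "a [^] m \<in> generate G ?X" if "m \<in> insert (ord a) (k ` I)" for m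
      using that a by (auto intro: generate.incl generate.one)
  qed
  then show "{a [^] ?g} \<subseteq> generate G ?X"
    by simp
qed (use a in \<open>auto intro!: generate_is_subgroup\<close>)

lemma card_generate_powers:
  assumes a: "a \<in> carrier G" "ord a > 0" and I: "finite I"
  shows "card (generate G ((\<lambda>i. a [^] (k i :: nat)) ` I)) = ord a div Gcd (insert (ord a) (k ` I))"
  unfolding generate_powers_eq_Gcd[OF a(1) I]
  using a by (subst generate_pow_card[symmetric]) (auto simp: ord_pow)

lemma finite_generate_singleton:
  assumes "a \<in> carrier G" "ord a > 0"
  shows "finite (generate G {a})"
  using assms generate_pow_card[of a] by (auto intro: card_ge_0_finite)

text \<open>Discrete logarithms are taken in \<open>{1..ord a}\<close> rather than from 0 on, to
  match the range of the tuples in \<open>jordan_totient\<close>.\<close>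

lemma bij_betw_pow_generate:
  assumes a: "a \<in> carrier G" "ord a > 0"
  shows "bij_betw (\<lambda>k. a [^] k) {1..ord a} (generate G {a})"
proof -
  have "(\<lambda>k. a [^] k) ` {1..ord a} = generate G {a}"
  proof (rule card_subset_eq)
    show "finite (generate G {a})"
      using a by (rule finite_generate_singleton)
    show "(\<lambda>k. a [^] k) ` {1..ord a} \<subseteq> generate G {a}"
      using a by (auto simp: generate_pow_nat)
    show "card ((\<lambda>k. a [^] k) ` {1..ord a}) = card (generate G {a})"
      using card_image[OF ord_inj'[OF a(1)]] generate_pow_card[OF a(1)] by simp
  qed
  then show ?thesis
    using ord_inj'[OF a(1)] by (simp add: bij_betw_def)
qed

text \<open>The gcd is the index of the generated subgroup in \<open>generate G {a}\<close>, and an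
  index is 1 exactly when the two groups agree.\<close>

lemma generate_powers_eq_generate_iff:
  assumes a: "a \<in> carrier G" "ord a > 0" and I: "finite I"
  shows "generate G ((\<lambda>i. a [^] (k i :: nat)) ` I) = generate G {a} \<longleftrightarrow>
    Gcd (insert (ord a) (k ` I)) = 1" (is "?L = ?R \<longleftrightarrow> ?g = 1")
proof
  assume "?L = ?R"
  then have "ord a div ?g = ord a"
    using card_generate_powers[OF a I, of k] generate_pow_card[OF a(1)] by simp
  then show "?g = 1"
    using a(2) by (simp add: div_eq_dividend_iff)
next
  assume "?g = 1"
  then show "?L = ?R"
    using generate_powers_eq_Gcd[OF a(1) I, of k] a(1) by simp
qed

text \<open>Raising \<open>a\<close> to each entry maps exponent tuples bijectively to tuples of
  group elements, and the gcd condition on the former is the generation condition on the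
  latter.\<close>

lemma jordan_totient_eq_card_generating_tuples:
  assumes a: "a \<in> carrier G" "ord a > 0"
  shows "jordan_totient r (ord a) =
    card {b \<in> {..<r} \<rightarrow>\<^sub>E generate G {a}. generate G (b ` {..<r}) = generate G {a}}"
proof -
  let ?K = "{k \<in> {..<r} \<rightarrow>\<^sub>E {1..ord a}. Gcd (insert (ord a) (k ` {..<r})) = 1}"
  let ?B = "{b \<in> {..<r} \<rightarrow>\<^sub>E generate G {a}. generate G (b ` {..<r}) = generate G {a}}"
  let ?f = "\<lambda>k. \<lambda>i\<in>{..<r}. a [^] (k i :: nat)"
  have bij: "bij_betw (\<lambda>k. a [^] k) {1..ord a} (generate G {a})"
    using a by (rule bij_betw_pow_generate)
  have iff: "generate G (?f k ` {..<r}) = generate G {a} \<longleftrightarrow> Gcd (insert (ord a) (k ` {..<r})) = 1" for k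
    using generate_powers_eq_generate_iff[OF a, of "{..<r}" k] by simp
  have "bij_betw ?f ?K ?B"
  proof (rule bij_betw_imageI)
    show "inj_on ?f ?K"
    proof (rule inj_onI)
      fix k l assume kl: "k \<in> ?K" "l \<in> ?K" "?f k = ?f l"
      show "k = l"
      proof (rule PiE_ext)
        show "k \<in> {..<r} \<rightarrow>\<^sub>E {1..ord a}" "l \<in> {..<r} \<rightarrow>\<^sub>E {1..ord a}"
          using kl by auto
        fix i assume i: "i \<in> {..<r}"
        then have "a [^] k i = a [^] l i"
          using fun_cong[OF kl(3), of i] by simp
        then show "k i = l i"
          using i kl bij by (auto simp: bij_betw_def dest!: inj_onD)
      qed
    qed
    show "?f ` ?K = ?B"
    proof (intro equalityI subsetI)
      fix b assume "b \<in> ?f ` ?K"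
      then obtain k where k: "k \<in> ?K" "b = ?f k" by blast
      have "?f k \<in> {..<r} \<rightarrow>\<^sub>E generate G {a}"
        using k(1) bij_betwE[OF bij] by (auto simp: PiE_iff)
      then show "b \<in> ?B"
        using k iff by blast
    next
      fix b assume b: "b \<in> ?B"
      \<comment> \<open>Entrywise discrete logarithms, restricted to \<open>{..<r}\<close> so that
        the tuple is extensional.\<close>
      let ?k = "\<lambda>i\<in>{..<r}. inv_into {1..ord a} (\<lambda>k. a [^] k) (b i)"
      have k: "?k \<in> {..<r} \<rightarrow>\<^sub>E {1..ord a}"
        using b bij_betwE[OF bij_betw_inv_into[OF bij]] by (auto simp: PiE_iff)
      have fk: "?f ?k = b"
      proof (rule PiE_ext)
        show "?f ?k \<in> {..<r} \<rightarrow>\<^sub>E UNIV" "b \<in> {..<r} \<rightarrow>\<^sub>E UNIV"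
          using b by (auto simp: PiE_iff)
        show "?f ?k i = b i" if "i \<in> {..<r}" for i
          using that b bij_betw_inv_into_right[OF bij, of "b i"] by (auto simp: PiE_iff)
      qed
      then have "?k \<in> ?K"
        using k b iff[of ?k] by simp
      then show "b \<in> ?f ` ?K"
        by (subst fk[symmetric]) (rule imageI)
    qed
  qed
  then show ?thesis
    unfolding jordan_totient_def by (rule bij_betw_same_card)
qed

section \<open>The subgroups of a finite cyclic group, indexed by their order\<close>

lemma ord_generator_B_sub:
  assumes "t \<in> carrier G" "ord t > 0" "n dvd ord t"
  shows "ord (t [^] (ord t div n)) = n"
proof -
  have "ord t div n dvd ord t" "ord t div n \<noteq> 0"
    using assms by (auto simp: dvd_div_eq_0_iff div_dvd_iff_mult)
  then show ?thesis
    using assms by (simp add: ord_pow div_div_divisor_nat)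
qed

lemma card_B_sub:
  assumes "t \<in> carrier G" "ord t > 0" "n dvd ord t"
  shows "card (B_sub G t (ord t) n) = n"
  using assms ord_generator_B_sub[OF assms] by (simp add: B_sub_def generate_pow_card)

text \<open>Write the entries as powers of \<open>t\<close> and let g be the gcd of the exponents
  and \<open>ord t\<close>. The generated subgroup has order n = \<open>ord t\<close> / g, so g =
  \<open>ord t\<close> / n, which is the exponent in \<open>B_sub\<close>.\<close>

lemma generate_tuple_eq_B_sub:
  fixes x :: "'i \<Rightarrow> 'a"
  assumes t: "t \<in> carrier G" "ord t > 0" and I: "finite I" and x: "x ` I \<subseteq> generate G {t}"
  defines "n \<equiv> card (generate G (x ` I))"
  shows "n dvd ord t" "generate G (x ` I) = B_sub G t (ord t) n"
proof -
  have "\<forall>i\<in>I. \<exists>k::nat. x i = t [^] k"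
    using x t by (auto simp: generate_pow_nat)
  then obtain k :: "'i \<Rightarrow> nat" where k: "\<forall>i\<in>I. x i = t [^] k i"
    by metis
  then have xk: "x ` I = (\<lambda>i. t [^] k i) ` I"
    by simp
  let ?g = "Gcd (insert (ord t) (k ` I))"
  have n: "n = ord t div ?g"
    unfolding n_def xk using t I by (rule card_generate_powers)
  have g: "?g dvd ord t"
    by (rule Gcd_dvd) simp
  then show "n dvd ord t"
    using t(2) by (auto simp: n div_dvd_iff_mult)
  have "ord t div n = ?g"
    unfolding n using g t(2) by (rule div_div_divisor_nat)
  then show "generate G (x ` I) = B_sub G t (ord t) n"
    unfolding B_sub_def xk using generate_powers_eq_Gcd[OF t(1) I, of k] by simp
qed

section \<open>Centralizers are closed under products and inverses\<close>

lemma commute_mult_left: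
  assumes "x \<in> carrier G" "y \<in> carrier G" "z \<in> carrier G"
    and "x \<otimes> z = z \<otimes> x" "y \<otimes> z = z \<otimes> y"
  shows "(x \<otimes> y) \<otimes> z = z \<otimes> (x \<otimes> y)"
  using assms by (metis m_assoc)

lemma commute_inv_left:
  assumes "x \<in> carrier G" "y \<in> carrier G" "x \<otimes> y = y \<otimes> x"
  shows "inv x \<otimes> y = y \<otimes> inv x"
proof -
  have "x \<otimes> (y \<otimes> inv x) = (y \<otimes> x) \<otimes> inv x"
    using assms by (simp add: m_assoc[symmetric])
  also have "\<dots> = y"
    using assms by (simp add: m_assoc)
  finally show ?thesis
    using assms inv_solve_left[of "y \<otimes> inv x" x y] by simp
qed

end

section \<open>Lifting tuples to commuting tuples of a semidirect product\<close>

locale semidirect_action = A: comm_group A + T: group T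
  for A :: "('a, 'm) monoid_scheme" and T :: "('b, 'n) monoid_scheme" +
  fixes act :: "'b \<Rightarrow> 'a \<Rightarrow> 'a"
  assumes act_hom: "act \<in> hom T (AutoGroup A)"
begin

abbreviation G :: "('a \<times> 'b) monoid"
  where "G \<equiv> semidirect A T act"

abbreviation Fix :: "'b set \<Rightarrow> 'a set"
  where "Fix X \<equiv> fixed_points A act X"

text \<open>The fibre over \<open>x\<close> of the projection of commuting tuples to
  \<open>T\<close>. Only the values of \<open>x\<close> below \<open>r\<close> are inspected, so
  total functions such as \<open>\<lambda>i. t [^] k i\<close> may stand for tuples.\<close>

definition lifts :: "nat \<Rightarrow> (nat \<Rightarrow> 'b) \<Rightarrow> (nat \<Rightarrow> 'a \<times> 'b) set"
  where "lifts r x = {g \<in> Hom_Zr r G. \<forall>i<r. snd (g i) = x i}"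

sublocale G: group G
  by (rule group_semidirect) (use act_hom A.is_group T.is_group in auto)

lemma act_auto: "x \<in> carrier T \<Longrightarrow> act x \<in> auto A"
  using act_hom by (auto simp: hom_def AutoGroup_def)

lemma act_group_hom: "x \<in> carrier T \<Longrightarrow> group_hom A A (act x)"
  using act_auto by (unfold_locales) (auto simp: auto_def)

lemma act_mult:
  assumes "x \<in> carrier T" "y \<in> carrier T" "a \<in> carrier A"
  shows "act (x \<otimes>\<^bsub>T\<^esub> y) a = act x (act y a)"
  using act_hom assms act_auto[OF assms(1)] act_auto[OF assms(2)]
  by (simp add: hom_def AutoGroup_def BijGroup_def auto_def compose_def)

lemma act_one: "a \<in> carrier A \<Longrightarrow> act \<one>\<^bsub>T\<^esub> a = a"
  using hom_one[OF act_hom T.is_group A.AutoGroup] by (simp add: AutoGroup_def BijGroup_def)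

lemma carrier_G: "carrier G = carrier A \<times> carrier T"
  by (simp add: semidirect_def)

lemma mult_G: "(a, x) \<otimes>\<^bsub>G\<^esub> (b, y) = (a \<otimes>\<^bsub>A\<^esub> act x b, x \<otimes>\<^bsub>T\<^esub> y)"
  by (simp add: semidirect_def)

lemma snd_mult_G: "snd (g \<otimes>\<^bsub>G\<^esub> h) = snd g \<otimes>\<^bsub>T\<^esub> snd h"
  by (cases g; cases h) (simp add: mult_G)

lemma snd_inv_G: "g \<in> carrier G \<Longrightarrow> snd (inv\<^bsub>G\<^esub> g) = inv\<^bsub>T\<^esub> (snd g)"
proof -
  have "group_hom G T snd"
    by unfold_locales (auto simp: hom_def carrier_G snd_mult_G mult_G)
  then show "g \<in> carrier G \<Longrightarrow> snd (inv\<^bsub>G\<^esub> g) = inv\<^bsub>T\<^esub> (snd g)"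
    by (rule group_hom.hom_inv)
qed

text \<open>This makes Lagrange's theorem available for the fixed points.\<close>

lemma subgroup_Fix:
  assumes "X \<subseteq> carrier T"
  shows "subgroup (Fix X) A"
proof
  show "Fix X \<subseteq> carrier A"
    by (auto simp: fixed_points_def)
  show "\<one>\<^bsub>A\<^esub> \<in> Fix X"
    using assms group_hom.hom_one[OF act_group_hom] by (auto simp: fixed_points_def)
  show "a \<otimes>\<^bsub>A\<^esub> b \<in> Fix X" if "a \<in> Fix X" "b \<in> Fix X" for a b
    using that assms group_hom.hom_mult[OF act_group_hom] by (auto simp: fixed_points_def subset_iff)
  show "inv\<^bsub>A\<^esub> a \<in> Fix X" if "a \<in> Fix X" for a
    using that assms group_hom.hom_inv[OF act_group_hom] by (auto simp: fixed_points_def subset_iff)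
qed

lemma subgroup_stabilizer:
  assumes "a \<in> carrier A"
  shows "subgroup {x \<in> carrier T. act x a = a} T"
proof
  show "{x \<in> carrier T. act x a = a} \<subseteq> carrier T"
    by auto
  show "x \<otimes>\<^bsub>T\<^esub> y \<in> {x \<in> carrier T. act x a = a}"
    if "x \<in> {x \<in> carrier T. act x a = a}" "y \<in> {x \<in> carrier T. act x a = a}" for x y
    using that assms by (simp add: act_mult)
  show "\<one>\<^bsub>T\<^esub> \<in> {x \<in> carrier T. act x a = a}"
    using assms by (simp add: act_one)
  show "inv\<^bsub>T\<^esub> x \<in> {x \<in> carrier T. act x a = a}" if "x \<in> {x \<in> carrier T. act x a = a}" for x
    using that assms act_mult[of "inv\<^bsub>T\<^esub> x" x a] by (simp add: act_one)
qed

text \<open>The stabilizer of \<open>a\<close> is a subgroup of \<open>T\<close>, so it contains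
  \<open>generate T X\<close> as soon as it contains \<open>X\<close>.\<close>

lemma Fix_generate:
  assumes "X \<subseteq> carrier T"
  shows "Fix (generate T X) = Fix X"
proof (intro equalityI subsetI)
  fix a assume "a \<in> Fix (generate T X)"
  then show "a \<in> Fix X"
    by (auto simp: fixed_points_def intro: generate.incl)
next
  fix a assume a: "a \<in> Fix X"
  then have "generate T X \<subseteq> {x \<in> carrier T. act x a = a}"
    using assms by (intro T.generate_subgroup_incl subgroup_stabilizer) (auto simp: fixed_points_def)
  with a show "a \<in> Fix (generate T X)"
    by (auto simp: fixed_points_def)
qed

section \<open>Elementary moves on commuting tuples\<close>

lemma Hom_Zr_update:
  assumes g: "g \<in> Hom_Zr r G" and i: "i < r" and h: "h \<in> carrier G"
    and comm: "\<And>l. l < r \<Longrightarrow> h \<otimes>\<^bsub>G\<^esub> g l = g l \<otimes>\<^bsub>G\<^esub> h"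
  shows "g(i := g i \<otimes>\<^bsub>G\<^esub> h) \<in> Hom_Zr r G"
proof -
  have gc: "g l \<in> carrier G" if "l < r" for l
    using g that by (auto simp: Hom_Zr_def)
  have gg: "g l \<otimes>\<^bsub>G\<^esub> g m = g m \<otimes>\<^bsub>G\<^esub> g l" if "l < r" "m < r" for l m
    using g that by (auto simp: Hom_Zr_def)
  have E: "g(i := g i \<otimes>\<^bsub>G\<^esub> h) \<in> {..<r} \<rightarrow>\<^sub>E carrier G"
    using g i h gc by (auto simp: Hom_Zr_def PiE_iff extensional_def)
  have "(g i \<otimes>\<^bsub>G\<^esub> h) \<otimes>\<^bsub>G\<^esub> g l = g l \<otimes>\<^bsub>G\<^esub> (g i \<otimes>\<^bsub>G\<^esub> h)" if "l < r" for l
    using that i h gc gg comm by (intro G.commute_mult_left) auto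
  with E show ?thesis
    using gg by (auto simp: Hom_Zr_def)
qed

text \<open>Multiplying entry \<open>i\<close> by entry \<open>j\<close> keeps a tuple commuting
  because its entries commute with \<open>g j\<close>. Since \<open>i \<noteq> j\<close>, entry
  \<open>j\<close> itself survives the move, and multiplying by its inverse undoes it.\<close>

lemma card_lifts_mult:
  assumes "i < r" "j < r" "i \<noteq> j" and x: "\<And>l. l < r \<Longrightarrow> x l \<in> carrier T"
  shows "card (lifts r (x(i := x i \<otimes>\<^bsub>T\<^esub> x j))) = card (lifts r x)"
proof -
  let ?x = "x(i := x i \<otimes>\<^bsub>T\<^esub> x j)"
  let ?f = "\<lambda>g. g(i := g i \<otimes>\<^bsub>G\<^esub> g j)"
  let ?f' = "\<lambda>g. g(i := g i \<otimes>\<^bsub>G\<^esub> inv\<^bsub>G\<^esub> (g j))"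
  have gc: "g l \<in> carrier G" if "g \<in> Hom_Zr r G" "l < r" for l g
    using that by (auto simp: Hom_Zr_def)
  have gg: "g l \<otimes>\<^bsub>G\<^esub> g m = g m \<otimes>\<^bsub>G\<^esub> g l" if "g \<in> Hom_Zr r G" "l < r" "m < r" for l m g
    using that by (auto simp: Hom_Zr_def)
  have gi: "inv\<^bsub>G\<^esub> (g l) \<otimes>\<^bsub>G\<^esub> g m = g m \<otimes>\<^bsub>G\<^esub> inv\<^bsub>G\<^esub> (g l)"
    if "g \<in> Hom_Zr r G" "l < r" "m < r" for l m g
    using that gc gg by (intro G.commute_inv_left) auto
  have "bij_betw ?f (lifts r x) (lifts r ?x)"
  proof (rule bij_betw_byWitness[where f' = ?f'])
    show "\<forall>g\<in>lifts r x. ?f' (?f g) = g"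
      using assms gc by (auto simp: lifts_def G.m_assoc)
    show "\<forall>g\<in>lifts r ?x. ?f (?f' g) = g"
      using assms gc by (auto simp: lifts_def G.m_assoc)
    show "?f ` lifts r x \<subseteq> lifts r ?x"
      using assms gc gg by (auto simp: lifts_def snd_mult_G intro!: Hom_Zr_update)
    show "?f' ` lifts r ?x \<subseteq> lifts r x"
      using assms gc gi
      by (auto simp: lifts_def snd_mult_G snd_inv_G T.m_assoc intro!: Hom_Zr_update)
  qed
  then show ?thesis
    by (rule bij_betw_same_card[symmetric])
qed

text \<open>Both tuples contain \<open>x j\<close>, and on an element fixed by \<open>x j\<close>
  the product of \<open>x i\<close> and \<open>x j\<close> acts as \<open>x i\<close> does.\<close>

lemma Fix_mult:
  assumes "i < r" "j < r" "i \<noteq> j" and x: "\<And>l. l < r \<Longrightarrow> x l \<in> carrier T"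
  shows "Fix ((x(i := x i \<otimes>\<^bsub>T\<^esub> x j)) ` {..<r}) = Fix (x ` {..<r})"
proof -
  let ?x = "x(i := x i \<otimes>\<^bsub>T\<^esub> x j)"
  have "(\<forall>l<r. act (?x l) a = a) \<longleftrightarrow> (\<forall>l<r. act (x l) a = a)" if a: "a \<in> carrier A" for a
  proof -
    have "act (x i \<otimes>\<^bsub>T\<^esub> x j) a = act (x i) a" if "act (x j) a = a"
      using that a assms by (simp add: act_mult)
    then show ?thesis
      using assms by (metis fun_upd_apply)
  qed
  then show ?thesis
    unfolding fixed_points_def ball_simps lessThan_iff Ball_def by blast
qed

text \<open>Elements over the identity commute with each other because \<open>A\<close> is abelian,
  and such an element commutes with one over \<open>x i\<close> iff its \<open>A\<close>-coordinate
  is fixed by \<open>x i\<close>. So entry \<open>i\<close> is free in \<open>A\<close> and the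
  other \<open>r - 1\<close> entries are free in the fixed points. The position \<open>i\<close> is
  arbitrary because Euclid's algorithm may stop at any index.\<close>

lemma card_lifts_single:
  assumes i: "i < r" and xi: "x i \<in> carrier T" and x: "\<And>l. l < r \<Longrightarrow> l \<noteq> i \<Longrightarrow> x l = \<one>\<^bsub>T\<^esub>"
  shows "card (lifts r x) = card (carrier A) * card (Fix (x ` {..<r})) ^ (r - 1)"
proof -
  let ?C = "Fix (x ` {..<r})"
  let ?P = "\<Pi>\<^sub>E l\<in>{..<r}. if l = i then carrier A else ?C"
  let ?f = "\<lambda>a. \<lambda>l\<in>{..<r}. (a l, x l)"
  let ?f' = "\<lambda>g. \<lambda>l\<in>{..<r}. fst (g l)"
  have xc: "x l \<in> carrier T" if "l < r" for l
    using x[OF that] xi by (cases "l = i") auto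
  \<comment> \<open>The other entries of \<open>x\<close> are the identity and impose no
    condition.\<close>
  have C: "?C = {a \<in> carrier A. act (x i) a = a}"
  proof (intro equalityI subsetI)
    fix a assume "a \<in> {a \<in> carrier A. act (x i) a = a}"
    then have "act (x l) a = a" if "l < r" for l
      using x[OF that] by (cases "l = i") (auto simp: act_one)
    with \<open>a \<in> _\<close> show "a \<in> ?C"
      by (auto simp: fixed_points_def)
  qed (use i in \<open>auto simp: fixed_points_def\<close>)
  have "bij_betw ?f ?P (lifts r x)"
  proof (rule bij_betw_byWitness[where f' = ?f'])
    show "\<forall>a\<in>?P. ?f' (?f a) = a"
      by (auto simp: fun_eq_iff PiE_def extensional_def)
    show "\<forall>g\<in>lifts r x. ?f (?f' g) = g"
      by (auto simp: fun_eq_iff lifts_def Hom_Zr_def PiE_def extensional_def prod_eq_iff)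
    show "?f ` ?P \<subseteq> lifts r x"
    proof (rule image_subsetI)
      fix a assume a: "a \<in> ?P"
      have aC: "a l \<in> carrier A" "act (x i) (a l) = a l" if "l < r" "l \<noteq> i" for l
        using PiE_mem[OF a, of l] that by (auto simp: C)
      have ai: "a i \<in> carrier A"
        using PiE_mem[OF a, of i] i by simp
      have ac: "a l \<in> carrier A" if "l < r" for l
        using aC ai that by (cases "l = i") auto
      have "(a l, x l) \<otimes>\<^bsub>G\<^esub> (a m, x m) = (a m, x m) \<otimes>\<^bsub>G\<^esub> (a l, x l)" if "l < r" "m < r" for l m
        using that aC ac x[of l] x[of m] xi
        by (cases "l = i"; cases "m = i") (auto simp: mult_G act_one A.m_comm)
      then show "?f a \<in> lifts r x"
        using ac xc by (auto simp: lifts_def Hom_Zr_def carrier_G)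
    qed
    show "?f' ` lifts r x \<subseteq> ?P"
    proof (rule image_subsetI)
      fix g assume g: "g \<in> lifts r x"
      have gl: "fst (g l) \<in> carrier A" "g l = (fst (g l), x l)" if "l < r" for l
        using g that by (auto simp: lifts_def Hom_Zr_def carrier_G PiE_iff mem_Times_iff prod_eq_iff)
      have "act (x i) (fst (g l)) = fst (g l)" if l: "l < r" "l \<noteq> i" for l
      proof -
        have "g i \<otimes>\<^bsub>G\<^esub> g l = g l \<otimes>\<^bsub>G\<^esub> g i"
          using g l i by (auto simp: lifts_def Hom_Zr_def)
        then have "(fst (g i), x i) \<otimes>\<^bsub>G\<^esub> (fst (g l), \<one>\<^bsub>T\<^esub>) = (fst (g l), \<one>\<^bsub>T\<^esub>) \<otimes>\<^bsub>G\<^esub> (fst (g i), x i)"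
          using gl(2)[OF i] gl(2)[OF l(1)] x[OF l] by simp
        \<comment> \<open>Comparing \<open>A\<close>-coordinates: the identity acts trivially and
          \<open>A\<close> is abelian, so \<open>fst (g i)\<close> can be cancelled.\<close>
        then have "fst (g i) \<otimes>\<^bsub>A\<^esub> act (x i) (fst (g l)) = fst (g i) \<otimes>\<^bsub>A\<^esub> fst (g l)"
          using gl(1)[OF i] gl(1)[OF l(1)] by (simp add: mult_G act_one A.m_comm)
        then show ?thesis
          using gl l i xi group_hom.hom_closed[OF act_group_hom[OF xi]] by simp
      qed
      then show "?f' g \<in> ?P"
        using gl by (auto simp: C)
    qed
  qed
  then have "card (lifts r x) = card ?P"
    by (rule bij_betw_same_card[symmetric])
  also have "\<dots> = (\<Prod>l<r. card (if l = i then carrier A else ?C))"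
    by (simp add: card_PiE)
  also have "\<dots> = card (carrier A) * (\<Prod>l\<in>{..<r} - {i}. card (if l = i then carrier A else ?C))"
    using i by (subst prod.remove[of _ i]) auto
  also have "(\<Prod>l\<in>{..<r} - {i}. card (if l = i then carrier A else ?C)) = (\<Prod>l\<in>{..<r} - {i}. card ?C)"
    by (intro prod.cong) auto
  also have "\<dots> = card ?C ^ (r - 1)"
    using i by simp
  finally show ?thesis .
qed

text \<open>Euclid's algorithm by repeated subtraction of exponents, with the sum of the exponents
  as measure. Each subtraction changes neither the number of lifts nor the fixed points.\<close>

lemma card_lifts_powers:
  fixes k :: "nat \<Rightarrow> nat"
  assumes t: "t \<in> carrier T" and r: "r \<ge> 1"
  shows "card (lifts r (\<lambda>i. t [^]\<^bsub>T\<^esub> k i)) =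
    card (carrier A) * card (Fix ((\<lambda>i. t [^]\<^bsub>T\<^esub> k i) ` {..<r})) ^ (r - 1)"
proof (induction "\<Sum>i<r. k i" arbitrary: k rule: less_induct)
  case less
  show ?case
  proof (cases "\<exists>i<r. \<exists>j<r. i \<noteq> j \<and> k j > 0 \<and> k j \<le> k i")
    case True
    then obtain i j where ij: "i < r" "j < r" "i \<noteq> j" "k j > 0" "k j \<le> k i"
      by blast
    define k' where "k' = k(i := k i - k j)"
    let ?x = "\<lambda>l. t [^]\<^bsub>T\<^esub> k' l"
    have "(\<Sum>l<r. k' l) < (\<Sum>l<r. k l)"
      using ij by (intro sum_strict_mono_ex1) (auto simp: k'_def)
    note IH = less[OF this]
    \<comment> \<open>The move is read backwards: the present tuple arises from the smaller one by
      multiplying entry \<open>i\<close> by entry \<open>j\<close>.\<close>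
    have x: "(\<lambda>l. t [^]\<^bsub>T\<^esub> k l) = ?x(i := ?x i \<otimes>\<^bsub>T\<^esub> ?x j)"
      using ij t by (auto simp: k'_def fun_eq_iff T.nat_pow_mult)
    show ?thesis
      unfolding x using IH ij t by (subst card_lifts_mult Fix_mult; simp)+
  next
    case False
    \<comment> \<open>If two exponents were positive, the smaller could be subtracted from the
      larger, so at most one is. If all vanish, index 0 serves, which lies below \<open>r\<close>
      because \<open>r \<ge> 1\<close>.\<close>
    have "\<exists>i<r. \<forall>l<r. l \<noteq> i \<longrightarrow> k l = 0"
    proof (cases "\<exists>i<r. k i > 0")
      case True
      then show ?thesis
        using False by (metis gr0I nle_le)
    qed (use r in \<open>auto intro!: exI[of _ 0]\<close>)
    then obtain i where "i < r" "\<And>l. l < r \<Longrightarrow> l \<noteq> i \<Longrightarrow> k l = 0"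
      by blast
    then show ?thesis
      using t by (intro card_lifts_single) auto
  qed
qed

section \<open>Summation over the image tuples and the subgroups they generate\<close>

lemma card_Hom_Zr_eq_sum_lifts:
  assumes "finite (carrier A)" "finite (carrier T)"
  shows "card (Hom_Zr r G) = (\<Sum>x\<in>{..<r} \<rightarrow>\<^sub>E carrier T. card (lifts r x))"
proof -
  let ?p = "\<lambda>g. \<lambda>i\<in>{..<r}. snd (g i)"
  have "finite ({..<r} \<rightarrow>\<^sub>E carrier G)"
    using assms by (intro finite_PiE) (auto simp: carrier_G)
  then have fin: "finite (Hom_Zr r G)"
    by (rule finite_subset[rotated]) (auto simp: Hom_Zr_def)
  have img: "?p ` Hom_Zr r G \<subseteq> {..<r} \<rightarrow>\<^sub>E carrier T"
  proof (rule image_subsetI)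
    fix g assume "g \<in> Hom_Zr r G"
    then have "g i \<in> carrier A \<times> carrier T" if "i < r" for i
      using that by (auto simp: Hom_Zr_def carrier_G)
    then show "?p g \<in> {..<r} \<rightarrow>\<^sub>E carrier T"
      by (auto simp: mem_Times_iff)
  qed
  have fibre: "{g \<in> Hom_Zr r G. ?p g = x} = lifts r x" if "x \<in> {..<r} \<rightarrow>\<^sub>E carrier T" for x
  proof -
    \<comment> \<open>Outside \<open>{..<r}\<close> both functions are \<open>undefined\<close>, so
      only the indices below \<open>r\<close> have to be compared.\<close>
    have "?p g = x \<longleftrightarrow> (\<forall>i<r. snd (g i) = x i)" for g :: "nat \<Rightarrow> 'a \<times> 'b"
      using PiE_arb[OF that] by (auto simp: fun_eq_iff)
    then show ?thesis
      by (simp add: lifts_def)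
  qed
  have "card (Hom_Zr r G) = (\<Sum>g\<in>Hom_Zr r G. 1)"
    by simp
  also have "\<dots> = (\<Sum>x\<in>{..<r} \<rightarrow>\<^sub>E carrier T. \<Sum>g | g \<in> Hom_Zr r G \<and> ?p g = x. 1)"
    using fin img assms by (intro sum.group[symmetric]) (auto intro: finite_PiE)
  also have "\<dots> = (\<Sum>x\<in>{..<r} \<rightarrow>\<^sub>E carrier T. card (lifts r x))"
    by (intro sum.cong refl) (simp add: fibre)
  finally show ?thesis .
qed

text \<open>The fixed points of \<open>x\<close> are those of the subgroup it generates, and in a
  cyclic group that subgroup is determined by its order \<open>n\<close>. Lagrange's theorem then
  splits |A| as |A:C| |C|, and the factor |C| raises the exponent \<open>r - 1\<close> to
  \<open>r\<close>, as \<open>r \<ge> 1\<close>.\<close>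

lemma card_lifts_eq_index:
  assumes t: "t \<in> carrier T" "T.ord t > 0" "carrier T = generate T {t}"
    and r: "r \<ge> 1" and x: "x \<in> {..<r} \<rightarrow>\<^sub>E carrier T"
    and n: "card (generate T (x ` {..<r})) = n"
  shows "card (lifts r x) = grp_index A (C_sub A T act t (T.ord t) n) * card (C_sub A T act t (T.ord t) n) ^ r"
proof -
  have xT: "x ` {..<r} \<subseteq> carrier T"
    using x by auto
  have B: "generate T (x ` {..<r}) = B_sub T t (T.ord t) n"
    using T.generate_tuple_eq_B_sub(2)[OF t(1,2), of "{..<r}" x] xT t(3) n by simp
  have C: "Fix (x ` {..<r}) = C_sub A T act t (T.ord t) n"
    using Fix_generate[OF xT] B by (simp add: C_sub_def)
  have "\<forall>i\<in>{..<r}. \<exists>k::nat. x i = t [^]\<^bsub>T\<^esub> k"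
    using xT t T.generate_pow_nat[of t] by blast
  then obtain k :: "nat \<Rightarrow> nat" where k: "\<forall>i\<in>{..<r}. x i = t [^]\<^bsub>T\<^esub> k i"
    by metis
  let ?y = "\<lambda>i. t [^]\<^bsub>T\<^esub> k i"
  have "lifts r x = lifts r ?y"
    using k by (auto simp: lifts_def)
  moreover have "x ` {..<r} = ?y ` {..<r}"
    using k by simp
  ultimately have "card (lifts r x) = card (carrier A) * card (Fix (x ` {..<r})) ^ (r - 1)"
    using card_lifts_powers[OF t(1) r, of k] by simp
  also have "card (carrier A) = grp_index A (Fix (x ` {..<r})) * card (Fix (x ` {..<r}))"
    using A.lagrange[OF subgroup_Fix[OF xT]] by (simp add: grp_index_def order_def)
  finally show ?thesis
    using r unfolding C by (cases r) simp_all
qed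

text \<open>Image tuples are grouped by the order of the subgroup they generate, a divisor of
  \<open>T.ord t\<close>. The summand is constant on each group.\<close>

theorem card_Hom_Zr_cyclic:
  assumes A: "finite (carrier A)"
    and t: "t \<in> carrier T" "T.ord t > 0" "carrier T = generate T {t}"
    and r: "r \<ge> 1"
  shows "card (Hom_Zr r G) = (\<Sum>n | n dvd T.ord t. grp_index A (C_sub A T act t (T.ord t) n)
    * card (C_sub A T act t (T.ord t) n) ^ r
    * card {b \<in> {..<r} \<rightarrow>\<^sub>E B_sub T t (T.ord t) n. generate T (b ` {..<r}) = B_sub T t (T.ord t) n})"
proof -
  let ?X = "{..<r} \<rightarrow>\<^sub>E carrier T"
  let ?c = "\<lambda>x. card (generate T (x ` {..<r}))"
  let ?B = "B_sub T t (T.ord t)" and ?C = "C_sub A T act t (T.ord t)"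
  have T: "finite (carrier T)"
    using T.finite_generate_singleton[OF t(1,2)] t(3) by simp
  then have finX: "finite ?X"
    by (auto intro: finite_PiE)
  have gen: "?c x dvd T.ord t" "generate T (x ` {..<r}) = ?B (?c x)" if "x \<in> ?X" for x
    using T.generate_tuple_eq_B_sub[OF t(1,2), of "{..<r}" x] that t(3) by auto
  \<comment> \<open>A tuple lies in the subgroup it generates, and \<open>?B n\<close> is the
    subgroup of order \<open>n\<close>; hence generating a subgroup of order \<open>n\<close> means
    being a generating tuple of \<open>?B n\<close>.\<close>
  have fibre: "{x \<in> ?X. ?c x = n} = {b \<in> {..<r} \<rightarrow>\<^sub>E ?B n. generate T (b ` {..<r}) = ?B n}"
    if n: "n dvd T.ord t" for n
  proof (intro equalityI subsetI)
    fix x assume x: "x \<in> {x \<in> ?X. ?c x = n}"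
    then have g: "generate T (x ` {..<r}) = ?B n"
      using gen by blast
    then have "x i \<in> ?B n" if "i < r" for i
      using that generate.incl[of "x i" "x ` {..<r}" T] by auto
    with x g show "x \<in> {b \<in> {..<r} \<rightarrow>\<^sub>E ?B n. generate T (b ` {..<r}) = ?B n}"
      by (auto simp: PiE_iff)
  next
    fix b assume b: "b \<in> {b \<in> {..<r} \<rightarrow>\<^sub>E ?B n. generate T (b ` {..<r}) = ?B n}"
    have "?B n \<subseteq> carrier T"
      unfolding B_sub_def using t(1) by (intro T.generate_incl) auto
    then show "b \<in> {x \<in> ?X. ?c x = n}"
      using b T.card_B_sub[OF t(1,2) n] by (auto simp: PiE_iff)
  qed
  have "card (Hom_Zr r G) = (\<Sum>x\<in>?X. card (lifts r x))"
    using A T by (rule card_Hom_Zr_eq_sum_lifts)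
  also have "\<dots> = (\<Sum>n | n dvd T.ord t. \<Sum>x | x \<in> ?X \<and> ?c x = n. card (lifts r x))"
    using finX t(2) gen(1) by (intro sum.group[symmetric]) auto
  also have "\<dots> = (\<Sum>n | n dvd T.ord t. \<Sum>x | x \<in> ?X \<and> ?c x = n. grp_index A (?C n) * card (?C n) ^ r)"
    using card_lifts_eq_index[OF t r] by (intro sum.cong refl) auto
  also have "\<dots> = (\<Sum>n | n dvd T.ord t. grp_index A (?C n) * card (?C n) ^ r
      * card {b \<in> {..<r} \<rightarrow>\<^sub>E ?B n. generate T (b ` {..<r}) = ?B n})"
    by (intro sum.cong refl) (simp add: fibre mult.commute)
  finally show ?thesis .
qed

end

section \<open>Passage from generating tuples to the totient and the double sum\<close>

theorem theorem4p9:
  fixes A :: "('a, 'm) monoid_scheme"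
    and T :: "('b, 'n) monoid_scheme"
    and act :: "'b \<Rightarrow> 'a \<Rightarrow> 'a"
    and t :: 'b and \<omega> r :: nat
  assumes "comm_group A" and "finite (carrier A)"
    and "group T" and "t \<in> carrier T" and "carrier T = generate T {t}"
    and "group.ord T t = \<omega>" and "\<omega> > 0"
    and "act \<in> hom T (AutoGroup A)"
    and "r \<ge> 1"
  shows "card (Hom_Zr r (semidirect A T act)) =
      (\<Sum>n | n dvd \<omega>. grp_index A (C_sub A T act t \<omega> n)
          * card (C_sub A T act t \<omega> n) ^ r * jordan_totient r n)
    \<and> (\<forall>n. n dvd \<omega> \<longrightarrow>
        jordan_totient r n =
          card {b \<in> {..<r} \<rightarrow>\<^sub>E B_sub T t \<omega> n. generate T (b ` {..<r}) = B_sub T t \<omega> n}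
        \<and> int (jordan_totient r n) = (\<Sum>d | d dvd n. moebius d * int (n div d) ^ r))
    \<and> int (card (Hom_Zr r (semidirect A T act))) =
      (\<Sum>n | n dvd \<omega>. \<Sum>d | d dvd n. moebius d * int (grp_index A (C_sub A T act t \<omega> n))
          * int (card (C_sub A T act t \<omega> n) * n div d) ^ r)"
proof -
  interpret A: comm_group A by fact
  interpret T: group T by fact
  interpret semidirect_action A T act
    by unfold_locales fact
  let ?C = "C_sub A T act t \<omega>" and ?B = "B_sub T t \<omega>"
  have ord: "T.ord t = \<omega>" "T.ord t > 0"
    using assms by auto
  have tuples: "jordan_totient r n = card {b \<in> {..<r} \<rightarrow>\<^sub>E ?B n. generate T (b ` {..<r}) = ?B n}"
    if "n dvd \<omega>" for n
  proof -
    \<comment> \<open>The generator of \<open>?B n\<close>; its order is \<open>n\<close>, so the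
      count of generating tuples applies to it.\<close>
    let ?u = "t [^]\<^bsub>T\<^esub> (\<omega> div n)"
    have "T.ord ?u = n"
      using T.ord_generator_B_sub[OF \<open>t \<in> carrier T\<close> ord(2)] that ord(1) by simp
    moreover have "n > 0"
      using that \<open>\<omega> > 0\<close> by (rule dvd_pos_nat[rotated])
    ultimately show ?thesis
      using T.jordan_totient_eq_card_generating_tuples[of ?u r] \<open>t \<in> carrier T\<close>
      by (simp add: B_sub_def)
  qed
  have moebius: "int (jordan_totient r n) = (\<Sum>d | d dvd n. moebius d * int (n div d) ^ r)"
    if "n dvd \<omega>" for n
    using that \<open>\<omega> > 0\<close> by (intro jordan_totient_moebius) (rule dvd_pos_nat)
  have count: "card (Hom_Zr r (semidirect A T act)) =
      (\<Sum>n | n dvd \<omega>. grp_index A (?C n) * card (?C n) ^ r * jordan_totient r n)"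
    using card_Hom_Zr_cyclic[OF \<open>finite (carrier A)\<close> \<open>t \<in> carrier T\<close> ord(2)
      \<open>carrier T = generate T {t}\<close> \<open>r \<ge> 1\<close>]
    by (simp add: ord(1) tuples)
  have "int (card (Hom_Zr r (semidirect A T act))) =
      (\<Sum>n | n dvd \<omega>. int (grp_index A (?C n)) * int (card (?C n)) ^ r * int (jordan_totient r n))"
    by (simp add: count)
  also have "\<dots> = (\<Sum>n | n dvd \<omega>. \<Sum>d | d dvd n. moebius d * int (grp_index A (?C n))
      * int (card (?C n) * n div d) ^ r)"
  proof (rule sum.cong)
    fix n assume "n \<in> {n. n dvd \<omega>}"
    then have n: "n dvd \<omega>" by simp
    \<comment> \<open>The division applies to the whole product; as \<open>d\<close> divides
      \<open>n\<close> it is exact, and the factor \<open>card (?C n)\<close> can be pulled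
      out.\<close>
    have "int (card (?C n) * n div d) ^ r = int (card (?C n)) ^ r * int (n div d) ^ r" if "d dvd n" for d
      using that by (simp add: power_mult_distrib flip: div_mult_swap)
    then show "int (grp_index A (?C n)) * int (card (?C n)) ^ r * int (jordan_totient r n) =
        (\<Sum>d | d dvd n. moebius d * int (grp_index A (?C n)) * int (card (?C n) * n div d) ^ r)"
      unfolding moebius[OF n] sum_distrib_left by (intro sum.cong refl) (simp add: mult_ac)
  qed simp
  finally show ?thesis
    using count tuples moebius by blast
qed

end
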